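(* Let $\beta>0$ and $h\in\mathbb{R}$. For $N\ge1$ and $x=(x_{ij})_{1\le i,j\le N}\in\mathbb{R}^{N^2}$ let $$Z_N(x)=\sum_{\sigma\in\{-1,1\}^N}\exp\Bigl(\frac{\beta}{\sqrt N}\sum_{1\le i,j\le N}x_{ij}\sigma_i\sigma_j+h\sum_{i=1}^N\sigma_i\Bigr),$$ let $g$ be an $N^2$-dimensional standard Gaussian vector, let $\Gamma_N(\lambda)=\frac{1}{\lambda N}\ln\mathbb{E}\,Z_N(g)^\lambda$ for $\lambda\ne0$ and $\Gamma_N(0)=\frac1N\mathbb{E}\ln Z_N(g)$, and let $\Gamma(\lambda)=\lim_{N\to\infty}\Gamma_N(\lambda)$ for $\lambda\in\mathbb{R}$. Then $\Gamma$ is differentiable at every $\lambda<0$, and its derivative satisfies $$\Gamma'(\lambda)=\lim_{N\to\infty}\Gamma_N'(\lambda).$$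
   Context: This is the Sherrington–Kirkpatrick model at inverse temperature $\beta$ and external field $h$. A standard Gaussian vector in $\mathbb{R}^{N^2}$, $g=(g_{ij})_{1\le i,j\le N}$, has i.i.d. $N(0,1)$ coordinates. The sum over $i,j$ in the exponent is over all ordered pairs, including $i=j$. The limit defining $\Gamma(\lambda)$ exists for every $\lambda\in\mathbb{R}$. *)

theory Defs
  imports "HOL-Probability.Probability"
begin

text \<open>Inverse temperature \<open>b\<close>, external field \<open>h\<close>, system size \<open>N\<close>.
  A disorder matrix is a function on pairs; only its values on
  \<open>{1..N} \<times> {1..N}\<close> matter.\<close>

definition spins :: "nat \<Rightarrow> (nat \<Rightarrow> real) set" where
  "spins N = {1..N} \<rightarrow>\<^sub>E {-1, 1}"

definition Z :: "real \<Rightarrow> real \<Rightarrow> nat \<Rightarrow> (nat \<times> nat \<Rightarrow> real) \<Rightarrow> real" where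
  "Z b h N x = (\<Sum>s\<in>spins N.
     exp (b / sqrt (real N) * (\<Sum>i=1..N. \<Sum>j=1..N. x (i, j) * s i * s j)
          + h * (\<Sum>i=1..N. s i)))"

text \<open>The law of the standard Gaussian vector with index set \<open>{1..N} \<times> {1..N}\<close>;
  expectations of functions of the vector are integrals against it.\<close>

definition std_gaussian :: "nat \<Rightarrow> (nat \<times> nat \<Rightarrow> real) measure" where
  "std_gaussian N = Pi\<^sub>M ({1..N} \<times> {1..N}) (\<lambda>_. density lborel (\<lambda>t. ennreal (std_normal_density t)))"

text \<open>For \<open>N = 0\<close> this is a junk value, irrelevant to limits in \<open>N\<close>.\<close>

definition Gamma_N :: "real \<Rightarrow> real \<Rightarrow> nat \<Rightarrow> real \<Rightarrow> real" where
  "Gamma_N b h N l =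
     (if l = 0 then (1 / real N) * (\<integral>x. ln (Z b h N x) \<partial>std_gaussian N)
      else 1 / (l * real N) * ln (\<integral>x. Z b h N x powr l \<partial>std_gaussian N))"

end

theory Submission
  imports Defs
begin

text \<open>Put \<open>f\<^sub>N(\<lambda>) = \<lambda> \<Gamma>\<^sub>N(\<lambda>) = N\<^sup>-\<^sup>1 ln E Z\<^sup>\<lambda>\<close>, a convex function. For \<open>\<lambda> < 0\<close> its
  second derivative is at most \<open>b\<^sup>2\<close>, uniformly in \<open>N\<close>: the function \<open>ln Z\<close> is convex in the disorder,
  so \<open>Z\<^sup>\<lambda>\<close> tilts the Gaussian measure to a strongly log-concave one, and \<open>ln Z\<close> has gradient of norm at
  most \<open>b \<surd>N\<close>. In finite-difference form, \<open>f\<^sub>N(\<lambda> + d) + f\<^sub>N(\<lambda> - d) \<le> 2 f\<^sub>N(\<lambda>) + b\<^sup>2 d\<^sup>2\<close>, this is the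
  midpoint Prekopa-Leindler inequality for the Gaussian vector applied to \<open>Z\<^sup>\<lambda>\<^sup>+\<^sup>d\<close>, \<open>Z\<^sup>\<lambda>\<^sup>-\<^sup>d\<close> and a multiple of
  \<open>Z\<^sup>\<lambda>\<close>. Convexity and the difference bound pass to the limit of \<open>f\<^sub>N\<close> and make every subgradient a derivative
  with an error in the first-order expansion that is uniform in \<open>N\<close>; hence the derivatives converge.\<close>

section \<open>The Prekopa-Leindler inequality on the real line\<close>

text \<open>Up to the single point \<open>Sup A\<close>, which is null, \<open>A\<close> is the
  increasing union of its truncations at points \<open>a n\<close> of \<open>A\<close> that approach
  the supremum. This replaces any assumption that \<open>A\<close> is bounded or contains its
  maximum.\<close>

lemma emeasure_lborel_le_by_truncation:
  fixes A :: "real set" and c d :: ennreal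
  assumes A: "A \<in> sets borel" "A \<noteq> {}"
    and le: "\<And>a. a \<in> A \<Longrightarrow> emeasure lborel (A \<inter> {..a}) + d \<le> c"
  shows "emeasure lborel A + d \<le> c"
proof -
  obtain u :: "nat \<Rightarrow> ereal" where u: "incseq u" "range u \<subseteq> ereal ` A"
      "Sup (ereal ` A) = (SUP n. u n)"
    using Sup_countable_SUP[of "ereal ` A"] A(2) by auto
  define a where "a n = real_of_ereal (u n)" for n
  have ua: "u n = ereal (a n)" "a n \<in> A" for n
  proof -
    have "u n \<in> ereal ` A" using u(2) by blast
    then show "u n = ereal (a n)" "a n \<in> A" unfolding a_def by auto
  qed
  have inc: "incseq a" using u(1) by (simp add: incseq_def ua)
  \<comment> \<open>If the supremum is infinite, \<open>s\<close> is the default value 0; this is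
    harmless, since only the nullity of \<open>{s}\<close> matters.\<close>
  define s where "s = real_of_ereal (Sup (ereal ` A))"
  have sub: "A \<subseteq> (\<Union>n. A \<inter> {..a n}) \<union> {s}"
  proof
    fix x assume x: "x \<in> A"
    have "ereal x \<le> (SUP n. u n)" unfolding u(3)[symmetric] by (rule Sup_upper) (use x in auto)
    then consider "ereal x < (SUP n. u n)" | "ereal x = (SUP n. u n)" by fastforce
    then show "x \<in> (\<Union>n. A \<inter> {..a n}) \<union> {s}"
    proof cases
      case 1
      then obtain n where "ereal x < u n" by (auto simp: less_SUP_iff)
      then show ?thesis using x by (auto simp: ua intro!: exI[of _ n])
    next
      case 2
      then have "x = s" unfolding s_def u(3) by (metis real_of_ereal.simps(1))
      then show ?thesis by simp
    qed
  qed
  have "emeasure lborel A \<le> emeasure lborel ((\<Union>n. A \<inter> {..a n}) \<union> {s})"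
    using A by (intro emeasure_mono sub) auto
  also have "\<dots> \<le> emeasure lborel (\<Union>n. A \<inter> {..a n}) + emeasure lborel {s}"
    using A by (intro emeasure_subadditive) auto
  also have "\<dots> = (SUP n. emeasure lborel (A \<inter> {..a n}))"
    using A inc by (subst SUP_emeasure_incseq[symmetric]) (auto simp: incseq_def intro: order_trans)
  finally have "emeasure lborel A + d \<le> (SUP n. emeasure lborel (A \<inter> {..a n})) + d"
    by (rule add_right_mono)
  also have "\<dots> = (SUP n. emeasure lborel (A \<inter> {..a n}) + d)"
    by (subst ennreal_SUP_add_left) auto
  also have "\<dots> \<le> c" using le ua(2) by (intro SUP_least) auto
  finally show ?thesis .
qed

lemma affine_vimage_borel:
  fixes A :: "real set"
  assumes "A \<in> sets borel"
  shows "(\<lambda>x. t + c * x) -` A \<in> sets borel"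
  using measurable_sets_borel[OF _ assms, of "\<lambda>x. t + c * x"] by simp

lemma emeasure_lborel_affine_vimage:
  fixes A :: "real set"
  assumes "A \<in> sets borel" "c \<noteq> 0"
  shows "emeasure lborel A = ennreal \<bar>c\<bar> * emeasure lborel ((\<lambda>x. t + c * x) -` A)"
proof -
  have m: "(\<lambda>x. t + c * x) -` A \<in> sets borel"
    by (rule affine_vimage_borel) fact
  have "emeasure lborel A = (\<integral>\<^sup>+x. indicator A x \<partial>lborel)" using assms by simp
  also have "\<dots> = ennreal \<bar>c\<bar> * (\<integral>\<^sup>+x. indicator A (t + c * x) \<partial>lborel)"
    using assms by (subst nn_integral_real_affine[where c=c and t=t]) auto
  also have "(\<lambda>x. indicator A (t + c * x) :: ennreal) = indicator ((\<lambda>x. t + c * x) -` A)"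
    by (auto simp: indicator_def)
  finally show ?thesis using m by simp
qed

text \<open>Truncate \<open>A\<close> on the right at some \<open>a\<close> in \<open>A\<close>, and
  \<open>B\<close> on the left at some \<open>b\<close> in \<open>B\<close>. The half-size copies of
  the truncated \<open>A\<close> shifted by \<open>b\<close> and of the truncated \<open>B\<close>
  shifted by \<open>a\<close> both lie in \<open>C\<close>, on opposite sides of
  \<open>(a + b) / 2\<close>, so their lengths add up. The truncations are then removed one after
  the other.\<close>

lemma brunn_minkowski_midpoint_real:
  fixes A B C :: "real set"
  assumes A: "A \<in> sets borel" "A \<noteq> {}" and B: "B \<in> sets borel" "B \<noteq> {}" and C: "C \<in> sets borel"
    and mid: "\<And>a b. a \<in> A \<Longrightarrow> b \<in> B \<Longrightarrow> (a + b) / 2 \<in> C"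
  shows "emeasure lborel A + emeasure lborel B \<le> 2 * emeasure lborel C"
proof -
  have *: "emeasure lborel (A \<inter> {..a}) + emeasure lborel (B \<inter> {b..}) \<le> 2 * emeasure lborel C"
    if ab: "a \<in> A" "b \<in> B" for a b
  proof -
    let ?A = "(\<lambda>x. - b + 2 * x) -` (A \<inter> {..a})" and ?B = "(\<lambda>x. - a + 2 * x) -` (B \<inter> {b..})"
    let ?m = "(a + b) / 2"
    have mA: "?A \<in> sets borel"
      by (rule affine_vimage_borel) (use A in auto)
    have mB: "?B \<in> sets borel"
      by (rule affine_vimage_borel) (use B in auto)
    have subA: "?A \<subseteq> C \<inter> {..?m}"
    proof
      fix x assume "x \<in> ?A"
      with mid[of "- b + 2 * x" b] ab show "x \<in> C \<inter> {..?m}" by (auto simp: field_simps)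
    qed
    have subB: "?B \<subseteq> C \<inter> {?m..}"
    proof
      fix x assume "x \<in> ?B"
      with mid[of a "- a + 2 * x"] ab show "x \<in> C \<inter> {?m..}" by (auto simp: field_simps)
    qed
    \<comment> \<open>Discarding the common endpoint makes the two pieces of \<open>C\<close>
      disjoint.\<close>
    have null: "emeasure lborel (C \<inter> {..?m}) = emeasure lborel (C \<inter> {..<?m})"
      by (intro emeasure_eq_AE) (use C AE_lborel_singleton[of ?m] in auto)
    have "emeasure lborel (A \<inter> {..a}) + emeasure lborel (B \<inter> {b..}) = 2 * (emeasure lborel ?A + emeasure lborel ?B)"
      using emeasure_lborel_affine_vimage[of "A \<inter> {..a}" 2 "-b"] emeasure_lborel_affine_vimage[of "B \<inter> {b..}" 2 "-a"] A B
      by (simp add: distrib_left)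
    also have "\<dots> \<le> 2 * (emeasure lborel (C \<inter> {..?m}) + emeasure lborel (C \<inter> {?m..}))"
      using C by (intro mult_left_mono add_mono emeasure_mono subA subB) auto
    also have "\<dots> = 2 * (emeasure lborel (C \<inter> {..<?m} \<union> C \<inter> {?m..}))"
      unfolding null using C by (subst plus_emeasure) auto
    also have "C \<inter> {..<?m} \<union> C \<inter> {?m..} = C" by auto
    finally show ?thesis .
  qed
  have **: "emeasure lborel A + emeasure lborel (B \<inter> {b..}) \<le> 2 * emeasure lborel C" if "b \<in> B" for b
    by (rule emeasure_lborel_le_by_truncation[OF A *[OF _ that]])
  \<comment> \<open>Truncation lifts only a cut on the right, so the left cut on \<open>B\<close> is
    handled after reflection at the origin.\<close>
  let ?B = "(\<lambda>x. 0 + (-1) * x) -` B"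
  have refl: "emeasure lborel X = emeasure lborel ((\<lambda>x. 0 + (-1) * x) -` X)" if "X \<in> sets borel" for X :: "real set"
    using emeasure_lborel_affine_vimage[OF that, of "-1" 0] by simp
  have mB: "?B \<in> sets borel" by (rule affine_vimage_borel) (use B in auto)
  have "emeasure lborel ?B + emeasure lborel A \<le> 2 * emeasure lborel C"
  proof (rule emeasure_lborel_le_by_truncation[OF mB])
    obtain b where "b \<in> B" using B(2) by blast
    then have "- b \<in> ?B" by simp
    then show "?B \<noteq> {}" by blast
    fix b assume "b \<in> ?B"
    then have b: "- b \<in> B" by simp
    have eq: "(\<lambda>x. 0 + (-1) * x) -` (B \<inter> {-b..}) = ?B \<inter> {..b}" by auto
    show "emeasure lborel (?B \<inter> {..b}) + emeasure lborel A \<le> 2 * emeasure lborel C"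
      using **[OF b] refl[of "B \<inter> {-b..}"] B unfolding eq by (simp add: add.commute)
  qed
  then show ?thesis using refl[OF B(1)] by (simp add: add.commute)
qed

text \<open>Layer-cake formula by Fubini, restricted to levels below 1: for functions with supremum
  1 these are the levels whose superlevel sets are nonempty, as the Brunn-Minkowski step
  requires.\<close>

lemma nn_integral_layer_cake_unit:
  fixes f :: "real \<Rightarrow> ennreal"
  assumes [measurable]: "f \<in> borel_measurable borel"
  shows "(\<integral>\<^sup>+x. min (f x) 1 \<partial>lborel) = (\<integral>\<^sup>+t. indicator {0..<1} t * emeasure lborel {x. ennreal t < f x} \<partial>lborel)"
proof -
  have "min (f x) 1 = (\<integral>\<^sup>+t. indicator {0..<1} t * indicator {x. ennreal t < f x} x \<partial>lborel)" for x
  proof -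
    define r where "r = enn2real (min (f x) 1)"
    have r: "min (f x) 1 = ennreal r" "r \<ge> 0"
      unfolding r_def by (auto simp: ennreal_enn2real_if min_def top_unique)
    have iff: "ennreal t < f x \<longleftrightarrow> t < r" if "0 \<le> t" "t < 1" for t
    proof -
      have "ennreal t < f x \<longleftrightarrow> ennreal t < min (f x) 1"
        using that by (auto simp: ennreal_less_one_iff)
      then show ?thesis using that by (simp add: r ennreal_less_iff)
    qed
    have "r \<le> 1" using r by (metis ennreal_le_1 min.cobounded2)
    have "(\<integral>\<^sup>+t. indicator {0..<1} t * indicator {x. ennreal t < f x} x \<partial>lborel) = (\<integral>\<^sup>+t. indicator {0..<r} t \<partial>lborel)"
      using iff \<open>r \<le> 1\<close> by (intro nn_integral_cong) (auto simp: indicator_def)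
    also have "\<dots> = ennreal r" using r by simp
    finally show ?thesis using r by simp
  qed
  then have "(\<integral>\<^sup>+x. min (f x) 1 \<partial>lborel)
      = (\<integral>\<^sup>+x. (\<integral>\<^sup>+t. indicator {0..<1} t * indicator {x. ennreal t < f x} x \<partial>lborel) \<partial>lborel)"
    by simp
  also have "\<dots> = (\<integral>\<^sup>+t. (\<integral>\<^sup>+x. indicator {0..<1} t * indicator {x. ennreal t < f x} x \<partial>lborel) \<partial>lborel)"
    by (rule lborel_pair.Fubini') measurable
  also have "\<dots> = (\<integral>\<^sup>+t. indicator {0..<1} t * emeasure lborel {x. ennreal t < f x} \<partial>lborel)"
    by (intro nn_integral_cong) (simp add: nn_integral_cmult)
  finally show ?thesis .
qed

text \<open>The inequality of arithmetic and geometric means, extended to infinite values.\<close>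

lemma ennreal_mult_le_square_of_add_le:
  fixes a b c :: ennreal
  assumes "a + b \<le> 2 * c"
  shows "a * b \<le> c\<^sup>2"
proof (cases "c = \<infinity>")
  case True
  then show ?thesis by (simp add: power2_eq_square)
next
  case False
  with assms have "a \<noteq> \<infinity>" "b \<noteq> \<infinity>" by (auto simp: ennreal_mult_eq_top_iff top_unique)
  with False obtain x y z where xyz: "a = ennreal x" "b = ennreal y" "c = ennreal z" "0 \<le> x" "0 \<le> y" "0 \<le> z"
    by (metis enn2real_nonneg ennreal_enn2real_if infinity_ennreal_def)
  have "ennreal (x + y) \<le> ennreal (2 * z)"
    using assms xyz by (simp add: ennreal_plus ennreal_mult'')
  then have "x + y \<le> 2 * z" using xyz by (subst (asm) ennreal_le_iff) auto
  then have "(x + y)\<^sup>2 \<le> (2 * z)\<^sup>2" using xyz by (intro power_mono) auto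
  moreover have "0 \<le> (x - y)\<^sup>2" by simp
  ultimately have "x * y \<le> z\<^sup>2" by (simp add: power2_eq_square algebra_simps)
  then show ?thesis using xyz by (simp add: ennreal_mult'[symmetric] ennreal_power)
qed

text \<open>When both suprema are 1, every level \<open>t\<close> in \<open>[0, 1)\<close> has
  nonempty superlevel sets for \<open>f\<close> and \<open>g\<close>, whose midpoints lie in that of
  \<open>h\<close>. Integrating Brunn-Minkowski over the levels bounds the sum of the two integrals
  by twice that of \<open>h\<close>, which implies the product form.\<close>

lemma prekopa_leindler_real_normalized:
  fixes f g h :: "real \<Rightarrow> ennreal"
  assumes [measurable]: "f \<in> borel_measurable borel" "g \<in> borel_measurable borel" "h \<in> borel_measurable borel"
    and sup: "(SUP x. f x) = 1" "(SUP x. g x) = 1"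
    and le: "\<And>x y. f x * g y \<le> (h ((x + y) / 2))\<^sup>2"
  shows "(\<integral>\<^sup>+x. f x \<partial>lborel) * (\<integral>\<^sup>+x. g x \<partial>lborel) \<le> (\<integral>\<^sup>+x. h x \<partial>lborel)\<^sup>2"
proof (rule ennreal_mult_le_square_of_add_le)
  let ?L = "\<lambda>f t. indicator {0..<1} t * emeasure lborel {x. ennreal t < (f x :: ennreal)}"
  have [measurable]: "?L f \<in> borel_measurable lborel" "?L g \<in> borel_measurable lborel" "?L h \<in> borel_measurable lborel"
    by measurable
  have fg: "f x \<le> 1" "g x \<le> 1" for x
    using SUP_upper[of x UNIV f] SUP_upper[of x UNIV g] sup by auto
  have level: "?L f t + ?L g t \<le> 2 * ?L h t" for t
  proof (cases "t \<in> {0..<1}")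
    case True
    then have t: "ennreal t < 1" by (simp add: ennreal_less_one_iff)
    have "emeasure lborel {x. ennreal t < f x} + emeasure lborel {x. ennreal t < g x} \<le> 2 * emeasure lborel {x. ennreal t < h x}"
    proof (rule brunn_minkowski_midpoint_real)
      show "{x. ennreal t < f x} \<noteq> {}" using t unfolding sup(1)[symmetric] by (auto simp: less_SUP_iff)
      show "{x. ennreal t < g x} \<noteq> {}" using t unfolding sup(2)[symmetric] by (auto simp: less_SUP_iff)
      fix x y assume xy: "x \<in> {x. ennreal t < f x}" "y \<in> {x. ennreal t < g x}"
      \<comment> \<open>An intermediate real level \<open>u\<close> carries the strict inequality
        through the product: \<open>t\<close> squared is below \<open>u\<close> squared, which is at
        most \<open>f x * g y\<close>.\<close>
      obtain u where u: "t < u" "ennreal u \<le> f x" "ennreal u \<le> g y"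
      proof -
        have "ennreal t < min (f x) (g y)" using xy by simp
        then obtain r where r: "ennreal t < r" "r < min (f x) (g y)" using dense by blast
        then have "r \<noteq> top" by auto
        then obtain u where "r = ennreal u" "0 \<le> u" by (cases r) auto
        with r True show ?thesis by (intro that[of u]) (auto simp: ennreal_less_iff)
      qed
      have "(ennreal t)\<^sup>2 < (ennreal u)\<^sup>2"
        using u(1) True by (auto simp: ennreal_power intro!: ennreal_lessI power_strict_mono)
      also have "(ennreal u)\<^sup>2 \<le> f x * g y"
        unfolding power2_eq_square by (rule mult_mono) (use u in auto)
      also note le[of x y]
      finally have "ennreal t < h ((x + y) / 2)"
        using power_mono_ennreal[of "h ((x + y) / 2)" "ennreal t" 2] by (meson leD leI)
      then show "(x + y) / 2 \<in> {x. ennreal t < h x}" by simp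
    qed measurable
    then show ?thesis using True by simp
  qed simp
  have "(\<integral>\<^sup>+x. f x \<partial>lborel) + (\<integral>\<^sup>+x. g x \<partial>lborel) = (\<integral>\<^sup>+x. min (f x) 1 \<partial>lborel) + (\<integral>\<^sup>+x. min (g x) 1 \<partial>lborel)"
    using fg by (simp add: min_absorb1)
  also have "\<dots> = (\<integral>\<^sup>+t. ?L f t + ?L g t \<partial>lborel)"
    by (simp add: nn_integral_layer_cake_unit nn_integral_add)
  also have "\<dots> \<le> (\<integral>\<^sup>+t. 2 * ?L h t \<partial>lborel)"
    by (intro nn_integral_mono level)
  also have "\<dots> = 2 * (\<integral>\<^sup>+t. ?L h t \<partial>lborel)"
    by (intro nn_integral_cmult) measurable
  also have "\<dots> = 2 * (\<integral>\<^sup>+x. min (h x) 1 \<partial>lborel)"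
    by (simp add: nn_integral_layer_cake_unit)
  \<comment> \<open>No upper bound on \<open>h\<close> is assumed; dropping its truncation at 1 only
    enlarges the right side.\<close>
  also have "\<dots> \<le> 2 * (\<integral>\<^sup>+x. h x \<partial>lborel)"
    by (intro mult_left_mono nn_integral_mono) auto
  finally show "(\<integral>\<^sup>+x. f x \<partial>lborel) + (\<integral>\<^sup>+x. g x \<partial>lborel) \<le> 2 * (\<integral>\<^sup>+x. h x \<partial>lborel)" .
qed

text \<open>Homogeneity reduces this to suprema equal to 1: divide \<open>f\<close> and
  \<open>g\<close> by their suprema and \<open>h\<close> by the geometric mean of these. If a
  supremum vanishes, the left side is 0.\<close>

lemma prekopa_leindler_real_bounded:
  fixes f g h :: "real \<Rightarrow> ennreal"
  assumes [measurable]: "f \<in> borel_measurable borel" "g \<in> borel_measurable borel" "h \<in> borel_measurable borel"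
    and fin: "(SUP x. f x) < \<infinity>" "(SUP x. g x) < \<infinity>"
    and le: "\<And>x y. f x * g y \<le> (h ((x + y) / 2))\<^sup>2"
  shows "(\<integral>\<^sup>+x. f x \<partial>lborel) * (\<integral>\<^sup>+x. g x \<partial>lborel) \<le> (\<integral>\<^sup>+x. h x \<partial>lborel)\<^sup>2"
proof (cases "(SUP x. f x) = 0 \<or> (SUP x. g x) = 0")
  case True
  then have "(\<forall>x. f x = 0) \<or> (\<forall>x. g x = 0)"
    by (metis SUP_upper UNIV_I le_zero_eq)
  then show ?thesis by auto
next
  case False
  have "\<exists>a>0. s = ennreal a" if "s \<noteq> 0" "s < \<infinity>" for s
    using that by (cases s) (auto simp: less_le)
  then obtain a b where ab: "(SUP x. f x) = ennreal a" "(SUP x. g x) = ennreal b" "a > 0" "b > 0"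
    using False fin by metis
  define c where "c = 1 / sqrt (a * b)"
  have c: "c > 0" "c\<^sup>2 = (1/a) * (1/b)" using ab by (simp_all add: c_def power_divide)
  let ?f = "\<lambda>x. ennreal (1/a) * f x" and ?g = "\<lambda>x. ennreal (1/b) * g x" and ?h = "\<lambda>x. ennreal c * h x"
  have cc: "ennreal (1/a) * ennreal (1/b) = (ennreal c)\<^sup>2"
    using ab c by (simp add: ennreal_power ennreal_mult[symmetric] del: divide_inverse)
  have "(\<integral>\<^sup>+x. ?f x \<partial>lborel) * (\<integral>\<^sup>+x. ?g x \<partial>lborel) \<le> (\<integral>\<^sup>+x. ?h x \<partial>lborel)\<^sup>2"
  proof (rule prekopa_leindler_real_normalized)
    show "(SUP x. ?f x) = 1" "(SUP x. ?g x) = 1"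
      using ab by (simp_all add: SUP_mult_left_ennreal[symmetric] ennreal_mult[symmetric] del: ennreal_1 flip: ennreal_1)
    fix x y
    have "?f x * ?g y = (ennreal c)\<^sup>2 * (f x * g y)" by (simp add: cc[symmetric] mult_ac)
    also have "\<dots> \<le> (ennreal c)\<^sup>2 * (h ((x + y) / 2))\<^sup>2" by (intro mult_left_mono le) simp
    finally show "?f x * ?g y \<le> (?h ((x + y) / 2))\<^sup>2" by (simp add: power_mult_distrib)
  qed measurable
  also have "(\<integral>\<^sup>+x. ?f x \<partial>lborel) = ennreal (1/a) * (\<integral>\<^sup>+x. f x \<partial>lborel)"
    by (rule nn_integral_cmult) measurable
  also have "(\<integral>\<^sup>+x. ?g x \<partial>lborel) = ennreal (1/b) * (\<integral>\<^sup>+x. g x \<partial>lborel)"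
    by (rule nn_integral_cmult) measurable
  also have "(\<integral>\<^sup>+x. ?h x \<partial>lborel) = ennreal c * (\<integral>\<^sup>+x. h x \<partial>lborel)"
    by (rule nn_integral_cmult) measurable
  also have "ennreal (1/a) * (\<integral>\<^sup>+x. f x \<partial>lborel) * (ennreal (1/b) * (\<integral>\<^sup>+x. g x \<partial>lborel))
      = (ennreal c)\<^sup>2 * ((\<integral>\<^sup>+x. f x \<partial>lborel) * (\<integral>\<^sup>+x. g x \<partial>lborel))"
    by (simp add: cc[symmetric] mult_ac)
  finally have "(ennreal c)\<^sup>2 * ((\<integral>\<^sup>+x. f x \<partial>lborel) * (\<integral>\<^sup>+x. g x \<partial>lborel)) \<le> (ennreal c)\<^sup>2 * (\<integral>\<^sup>+x. h x \<partial>lborel)\<^sup>2"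
    by (simp add: power_mult_distrib)
  moreover have "(ennreal c)\<^sup>2 = ennreal (c\<^sup>2)" "c\<^sup>2 > 0" using \<open>c > 0\<close> by (simp_all add: ennreal_power)
  ultimately show ?thesis by (simp add: ennreal_mult_le_mult_iff del: zero_less_power2)
qed

lemma nn_integral_SUP_min_of_nat:
  fixes f :: "'a \<Rightarrow> ennreal"
  assumes [measurable]: "f \<in> borel_measurable M"
  shows "(\<integral>\<^sup>+x. f x \<partial>M) = (SUP n. \<integral>\<^sup>+x. min (f x) (of_nat n) \<partial>M)"
proof -
  have "f x = (SUP n. min (f x) (of_nat n))" for x
    by (simp add: inf_min[symmetric] inf_SUP[symmetric] ennreal_SUP_of_nat_eq_top)
  then have "(\<integral>\<^sup>+x. f x \<partial>M) = (\<integral>\<^sup>+x. (SUP n. min (f x) (of_nat n)) \<partial>M)" by simp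
  also have "\<dots> = (SUP n. \<integral>\<^sup>+x. min (f x) (of_nat n) \<partial>M)"
    by (intro nn_integral_monotone_convergence_SUP) (auto simp: incseq_def le_fun_def min.coboundedI2)
  finally show ?thesis .
qed

text \<open>Truncating \<open>f\<close> and \<open>g\<close> at integers preserves the pointwise
  hypothesis with the same \<open>h\<close>; monotone convergence then removes the
  truncations.\<close>

lemma prekopa_leindler_real:
  fixes f g h :: "real \<Rightarrow> ennreal"
  assumes [measurable]: "f \<in> borel_measurable borel" "g \<in> borel_measurable borel" "h \<in> borel_measurable borel"
    and le: "\<And>x y. f x * g y \<le> (h ((x + y) / 2))\<^sup>2"
  shows "(\<integral>\<^sup>+x. f x \<partial>lborel) * (\<integral>\<^sup>+x. g x \<partial>lborel) \<le> (\<integral>\<^sup>+x. h x \<partial>lborel)\<^sup>2"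
proof -
  have "(\<integral>\<^sup>+x. min (f x) (of_nat m) \<partial>lborel) * (\<integral>\<^sup>+x. min (g x) (of_nat n) \<partial>lborel) \<le> (\<integral>\<^sup>+x. h x \<partial>lborel)\<^sup>2" for m n
  proof (rule prekopa_leindler_real_bounded)
    have "(SUP x. min (u x) (of_nat k)) < \<infinity>" for u :: "real \<Rightarrow> ennreal" and k
    proof -
      have "(SUP x. min (u x) (of_nat k)) \<le> of_nat k" by (intro SUP_least) auto
      also have "\<dots> < \<infinity>" by (simp add: of_nat_less_top)
      finally show ?thesis .
    qed
    then show "(SUP x. min (f x) (of_nat m)) < \<infinity>" "(SUP x. min (g x) (of_nat n)) < \<infinity>" by auto
    show "min (f x) (of_nat m) * min (g y) (of_nat n) \<le> (h ((x + y) / 2))\<^sup>2" for x y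
      by (rule order_trans[OF mult_mono le]) auto
  qed measurable
  then show ?thesis
    by (simp add: nn_integral_SUP_min_of_nat[of f] nn_integral_SUP_min_of_nat[of g]
        SUP_mult_left_ennreal SUP_mult_right_ennreal SUP_least)
qed

section \<open>The Prekopa-Leindler inequality for Gaussian vectors\<close>

text \<open>Tensorization by induction on the coordinates. The assumption \<open>factor\<close> is
  the inequality on one factor, with midpoint map \<open>m\<close> and a weight \<open>k\<close>.
  Applied to the fibres over fixed remaining coordinates, it gives the pointwise hypothesis for the
  partial integrals \<open>F\<close>, to which the induction hypothesis applies.\<close>

lemma prekopa_leindler_PiM:
  fixes M :: "'a measure" and k :: "'a \<Rightarrow> 'a \<Rightarrow> ennreal" and m :: "'a \<Rightarrow> 'a \<Rightarrow> 'a"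
  assumes "sigma_finite_measure M"
    and m: "\<And>x y. x \<in> space M \<Longrightarrow> y \<in> space M \<Longrightarrow> m x y \<in> space M"
    and factor: "\<And>f g h. f \<in> borel_measurable M \<Longrightarrow> g \<in> borel_measurable M \<Longrightarrow> h \<in> borel_measurable M \<Longrightarrow>
      (\<And>x y. x \<in> space M \<Longrightarrow> y \<in> space M \<Longrightarrow> f x * g y * k x y \<le> (h (m x y))\<^sup>2) \<Longrightarrow>
      (\<integral>\<^sup>+x. f x \<partial>M) * (\<integral>\<^sup>+x. g x \<partial>M) \<le> (\<integral>\<^sup>+x. h x \<partial>M)\<^sup>2"
    and "finite I"
    and "f \<in> borel_measurable (Pi\<^sub>M I (\<lambda>_. M))" "g \<in> borel_measurable (Pi\<^sub>M I (\<lambda>_. M))"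
      "h \<in> borel_measurable (Pi\<^sub>M I (\<lambda>_. M))"
    and "\<And>x y. x \<in> space (Pi\<^sub>M I (\<lambda>_. M)) \<Longrightarrow> y \<in> space (Pi\<^sub>M I (\<lambda>_. M)) \<Longrightarrow>
      f x * g y * (\<Prod>i\<in>I. k (x i) (y i)) \<le> (h (\<lambda>i\<in>I. m (x i) (y i)))\<^sup>2"
  shows "(\<integral>\<^sup>+x. f x \<partial>Pi\<^sub>M I (\<lambda>_. M)) * (\<integral>\<^sup>+x. g x \<partial>Pi\<^sub>M I (\<lambda>_. M)) \<le> (\<integral>\<^sup>+x. h x \<partial>Pi\<^sub>M I (\<lambda>_. M))\<^sup>2"
  using assms(4-)
proof (induction I arbitrary: f g h)
  case empty
  interpret product_sigma_finite "\<lambda>_. M" using assms(1) by (simp add: product_sigma_finite_def)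
  show ?case
    using empty.prems(4)[of "\<lambda>_. undefined" "\<lambda>_. undefined"] by (simp add: nn_integral_empty restrict_def space_PiM)
next
  case (insert i I)
  interpret product_sigma_finite "\<lambda>_. M" using assms(1) by (simp add: product_sigma_finite_def)
  interpret sigma_finite_measure M by fact
  let ?P = "Pi\<^sub>M I (\<lambda>_. M)"
  note [measurable] = insert.prems(1-3)
  define F where "F u x = (\<integral>\<^sup>+s. u (x(i := s)) \<partial>M)" for u :: "('b \<Rightarrow> 'a) \<Rightarrow> ennreal" and x
  have F: "F u \<in> borel_measurable ?P" "(\<integral>\<^sup>+x. u x \<partial>Pi\<^sub>M (insert i I) (\<lambda>_. M)) = (\<integral>\<^sup>+x. F u x \<partial>?P)"
    if [measurable]: "u \<in> borel_measurable (Pi\<^sub>M (insert i I) (\<lambda>_. M))" for u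
  proof -
    show "F u \<in> borel_measurable ?P" unfolding F_def by measurable
    show "(\<integral>\<^sup>+x. u x \<partial>Pi\<^sub>M (insert i I) (\<lambda>_. M)) = (\<integral>\<^sup>+x. F u x \<partial>?P)"
      unfolding F_def using insert.hyps by (intro product_nn_integral_insert) auto
  qed
  have "F f x * F g y * (\<Prod>j\<in>I. k (x j) (y j)) \<le> (F h (\<lambda>j\<in>I. m (x j) (y j)))\<^sup>2"
    if xy[measurable]: "x \<in> space ?P" "y \<in> space ?P" for x y
  proof -
    let ?z = "\<lambda>j\<in>I. m (x j) (y j)" and ?K = "\<Prod>j\<in>I. k (x j) (y j)"
    have z: "?z \<in> space ?P" using xy m by (auto simp: space_PiM PiE_iff)
    have meas: "(\<lambda>s. u (w(i := s))) \<in> borel_measurable M"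
      if "u \<in> borel_measurable (Pi\<^sub>M (insert i I) (\<lambda>_. M))" "w \<in> space ?P" for u :: "('b \<Rightarrow> 'a) \<Rightarrow> ennreal" and w
      using measurable_compose[OF measurable_component_update[OF that(2) insert.hyps(2)] that(1)] .
    note [measurable] = meas[OF insert.prems(1) xy(1)] meas[OF insert.prems(2) xy(2)] meas[OF insert.prems(3) z]
    \<comment> \<open>The weight \<open>?K\<close> of the remaining coordinates is constant in
      \<open>s\<close>, so it can be attached to the first function and pulled out of the integral
      afterwards.\<close>
    have "(\<integral>\<^sup>+s. f (x(i := s)) * ?K \<partial>M) * (\<integral>\<^sup>+s. g (y(i := s)) \<partial>M) \<le> (\<integral>\<^sup>+s. h (?z(i := s)) \<partial>M)\<^sup>2"
    proof (rule factor)
      fix s t assume st: "s \<in> space M" "t \<in> space M"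
      let ?x = "x(i := s)" and ?y = "y(i := t)"
      have "(\<Prod>j\<in>I. k (?x j) (?y j)) = ?K"
        using insert.hyps by (intro prod.cong) auto
      then have K: "(\<Prod>j\<in>insert i I. k (?x j) (?y j)) = k s t * ?K"
        using insert.hyps by simp
      have z': "(\<lambda>j\<in>insert i I. m (?x j) (?y j)) = ?z(i := m s t)"
        using insert.hyps by (auto simp: fun_eq_iff)
      have "?x \<in> space (Pi\<^sub>M (insert i I) (\<lambda>_. M))" "?y \<in> space (Pi\<^sub>M (insert i I) (\<lambda>_. M))"
        using xy st by (auto simp: space_PiM PiE_iff extensional_def)
      from insert.prems(4)[OF this]
      have "f ?x * g ?y * (k s t * ?K) \<le> (h (?z(i := m s t)))\<^sup>2"
        unfolding K z' .
      moreover have "a * c * b * d = a * b * (d * c)" for a b c d :: ennreal by (simp add: mult_ac)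
      ultimately show "f ?x * ?K * g ?y * k s t \<le> (h (?z(i := m s t)))\<^sup>2" by metis
    qed measurable
    also have "(\<integral>\<^sup>+s. f (x(i := s)) * ?K \<partial>M) = (\<integral>\<^sup>+s. f (x(i := s)) \<partial>M) * ?K"
      by (rule nn_integral_multc) measurable
    finally show ?thesis
      unfolding F_def by (simp only: mult.assoc mult.commute mult.left_commute)
  qed
  then show ?case
    unfolding F(2)[OF insert.prems(1)] F(2)[OF insert.prems(2)] F(2)[OF insert.prems(3)]
    by (intro insert.IH F(1) insert.prems(1-3))
qed

abbreviation gaussian :: "real measure" where
  "gaussian \<equiv> density lborel (\<lambda>t. ennreal (std_normal_density t))"

text \<open>By the parallelogram identity, the product of the Gaussian densities at \<open>x\<close>
  and \<open>y\<close> is the squared density at the midpoint times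
  \<open>exp (- (x - y)^2 / 4)\<close>. Hence the hypothesis is that of the Lebesgue version for the
  functions multiplied by the density.\<close>

lemma prekopa_leindler_gaussian:
  fixes f g h :: "real \<Rightarrow> ennreal"
  assumes [measurable]: "f \<in> borel_measurable borel" "g \<in> borel_measurable borel" "h \<in> borel_measurable borel"
    and le: "\<And>x y. f x * g y * ennreal (exp (- (x - y)\<^sup>2 / 4)) \<le> (h ((x + y) / 2))\<^sup>2"
  shows "(\<integral>\<^sup>+x. f x \<partial>gaussian) * (\<integral>\<^sup>+x. g x \<partial>gaussian) \<le> (\<integral>\<^sup>+x. h x \<partial>gaussian)\<^sup>2"
proof -
  let ?p = "\<lambda>x. ennreal (std_normal_density x)"
  have p: "?p x * ?p y = ennreal (exp (- (x - y)\<^sup>2 / 4)) * (?p ((x + y) / 2))\<^sup>2" for x y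
  proof -
    have "- x\<^sup>2 / 2 + - y\<^sup>2 / 2 = - (x - y)\<^sup>2 / 4 + (- ((x + y) / 2)\<^sup>2 / 2 + - ((x + y) / 2)\<^sup>2 / 2)"
      by (simp add: power2_eq_square field_simps)
    then have "std_normal_density x * std_normal_density y
        = exp (- (x - y)\<^sup>2 / 4) * (std_normal_density ((x + y) / 2))\<^sup>2"
      unfolding std_normal_density_def power2_eq_square[of "_ * _"]
      by (simp add: mult_exp_exp mult_ac del: minus_divide_left)
    then show ?thesis by (simp add: ennreal_mult[symmetric] ennreal_power)
  qed
  have "(\<integral>\<^sup>+x. ?p x * f x \<partial>lborel) * (\<integral>\<^sup>+x. ?p x * g x \<partial>lborel) \<le> (\<integral>\<^sup>+x. ?p x * h x \<partial>lborel)\<^sup>2"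
  proof (rule prekopa_leindler_real)
    fix x y
    have "?p x * f x * (?p y * g y) = (?p x * ?p y) * (f x * g y)" by (simp add: mult_ac)
    also have "\<dots> = (f x * g y * ennreal (exp (- (x - y)\<^sup>2 / 4))) * (?p ((x + y) / 2))\<^sup>2"
      unfolding p by (simp add: mult_ac)
    also have "\<dots> \<le> (h ((x + y) / 2))\<^sup>2 * (?p ((x + y) / 2))\<^sup>2" by (intro mult_right_mono le) simp
    finally show "?p x * f x * (?p y * g y) \<le> (?p ((x + y) / 2) * h ((x + y) / 2))\<^sup>2"
      by (simp add: power_mult_distrib mult_ac)
  qed measurable
  then show ?thesis by (simp add: nn_integral_density)
qed

text \<open>The coordinate weights multiply to a Gaussian factor in the Euclidean distance. This
  factor expresses the strong log-concavity of the measure, with a constant independent of the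
  dimension.\<close>

lemma prekopa_leindler_std_gaussian:
  fixes f g h :: "(nat \<times> nat \<Rightarrow> real) \<Rightarrow> ennreal"
  assumes "f \<in> borel_measurable (std_gaussian N)" "g \<in> borel_measurable (std_gaussian N)"
      "h \<in> borel_measurable (std_gaussian N)"
    and le: "\<And>x y. f x * g y * ennreal (exp (- (\<Sum>p\<in>{1..N} \<times> {1..N}. (x p - y p)\<^sup>2) / 4))
      \<le> (h (\<lambda>p\<in>{1..N} \<times> {1..N}. (x p + y p) / 2))\<^sup>2"
  shows "(\<integral>\<^sup>+x. f x \<partial>std_gaussian N) * (\<integral>\<^sup>+x. g x \<partial>std_gaussian N) \<le> (\<integral>\<^sup>+x. h x \<partial>std_gaussian N)\<^sup>2"
  unfolding std_gaussian_def
proof (rule prekopa_leindler_PiM[where k = "\<lambda>x y. ennreal (exp (- (x - y)\<^sup>2 / 4))" and m = "\<lambda>x y. (x + y) / 2"])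
  show "sigma_finite_measure gaussian"
    by (intro prob_space_imp_sigma_finite prob_space_normal_density) simp
  have "(\<Prod>p\<in>I. ennreal (exp (- (x p - y p)\<^sup>2 / 4))) = ennreal (exp (- (\<Sum>p\<in>I. (x p - y p)\<^sup>2) / 4))"
    if "finite I" for I and x y :: "nat \<times> nat \<Rightarrow> real"
    using that by (simp add: prod_ennreal exp_sum[symmetric] sum_divide_distrib sum_negf)
  then show "f x * g y * (\<Prod>p\<in>{1..N} \<times> {1..N}. ennreal (exp (- (x p - y p)\<^sup>2 / 4)))
      \<le> (h (\<lambda>p\<in>{1..N} \<times> {1..N}. (x p + y p) / 2))\<^sup>2" for x y
    using le by simp
qed (use assms(1-3) in \<open>auto simp: std_gaussian_def intro!: prekopa_leindler_gaussian\<close>)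

section \<open>Limits of convex and semiconcave functions\<close>

text \<open>Convexity supplies a supporting line of slope \<open>D\<close>, hence the lower bound at
  both \<open>x + d\<close> and \<open>x - d\<close>. Inserting the one at \<open>x - d\<close> into
  the second-difference bound gives the upper bound at \<open>x + d\<close>.\<close>

lemma convex_on_semiconcave_taylor:
  fixes f :: "real \<Rightarrow> real"
  assumes conv: "convex_on S f" and S: "open S"
    and semi: "\<And>x d. x + d \<in> S \<Longrightarrow> x - d \<in> S \<Longrightarrow> f (x + d) + f (x - d) \<le> 2 * f x + C * d\<^sup>2"
    and x: "x \<in> S"
  obtains D where "\<And>d. x + d \<in> S \<Longrightarrow> x - d \<in> S \<Longrightarrow> \<bar>f (x + d) - f x - D * d\<bar> \<le> C * d\<^sup>2"
proof -
  \<comment> \<open>The infimum of the difference quotients to the right of \<open>x\<close>, that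
    is, the right derivative of \<open>f\<close> at \<open>x\<close>.\<close>
  define D where "D = Inf ((\<lambda>t. (f x - f t) / (x - t)) ` ({x<..} \<inter> S))"
  have sub: "f x + D * (y - x) \<le> f y" if "y \<in> S" for y
    using convex_le_Inf_differential[OF conv, of x y] x S that by (simp add: D_def interior_open)
  have "\<bar>f (x + d) - f x - D * d\<bar> \<le> C * d\<^sup>2" if "x + d \<in> S" "x - d \<in> S" for d
    using sub[OF that(1)] sub[OF that(2)] semi[OF that] by (auto simp: algebra_simps)
  then show thesis by (rule that)
qed

lemma has_field_derivative_of_quadratic_bound:
  fixes f :: "real \<Rightarrow> real"
  assumes "r > 0" and bd: "\<And>d. \<bar>d\<bar> < r \<Longrightarrow> \<bar>f (x + d) - f x - D * d\<bar> \<le> C * d\<^sup>2"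
  shows "(f has_field_derivative D) (at x)"
  unfolding DERIV_def
proof (rule Lim_transform)
  show "(\<lambda>d::real. D) \<midarrow>0\<rightarrow> D" by simp
  show "(\<lambda>d. (f (x + d) - f x) / d - D) \<midarrow>0\<rightarrow> 0"
  proof (rule Lim_null_comparison)
    show "(\<lambda>d. C * \<bar>d\<bar>) \<midarrow>0\<rightarrow> 0"
      using tendsto_mult[OF tendsto_const[of C] tendsto_rabs[OF tendsto_ident_at[of 0 UNIV]]] by simp
    have "norm ((f (x + d) - f x) / d - D) \<le> C * \<bar>d\<bar>" if "d \<noteq> 0" "\<bar>d\<bar> < r" for d
    proof -
      have "norm ((f (x + d) - f x) / d - D) = \<bar>f (x + d) - f x - D * d\<bar> / \<bar>d\<bar>"
      proof -
        have "(f (x + d) - f x) / d - D = (f (x + d) - f x - D * d) / d"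
          using that by (simp add: field_simps)
        then show ?thesis by (simp only: real_norm_def abs_divide)
      qed
      also have "\<dots> \<le> C * d\<^sup>2 / \<bar>d\<bar>" using bd[OF that(2)] by (intro divide_right_mono) auto
      also have "\<dots> = C * \<bar>d\<bar>" using that by (simp add: power2_eq_square abs_if)
      finally show ?thesis .
    qed
    then show "\<forall>\<^sub>F d in at 0. norm ((f (x + d) - f x) / d - D) \<le> C * \<bar>d\<bar>"
      unfolding eventually_at using \<open>r > 0\<close> by (auto simp: dist_real_def)
  qed
qed

text \<open>Both hypotheses survive pointwise limits, so all \<open>f n\<close> with
  \<open>n > 0\<close> and the limit \<open>g\<close> have first-order expansions at
  \<open>x\<close> with the same remainder bound \<open>C * d^2\<close>. At a fixed small step
  \<open>d\<close>, comparing increments therefore compares slopes up to \<open>2 * C * d\<close>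
  plus an error vanishing in \<open>n\<close>.\<close>

lemma convex_semiconcave_limit_derivative:
  fixes f :: "nat \<Rightarrow> real \<Rightarrow> real" and g :: "real \<Rightarrow> real"
  assumes S: "open S" "x \<in> S"
    and conv: "\<And>n. n > 0 \<Longrightarrow> convex_on S (f n)"
    and semi: "\<And>n x d. n > 0 \<Longrightarrow> x + d \<in> S \<Longrightarrow> x - d \<in> S \<Longrightarrow> f n (x + d) + f n (x - d) \<le> 2 * f n x + C * d\<^sup>2"
    and lim: "\<And>x. x \<in> S \<Longrightarrow> (\<lambda>n. f n x) \<longlonglongrightarrow> g x"
  obtains D D' where "\<And>n. n > 0 \<Longrightarrow> (f n has_field_derivative D n) (at x)"
    "(g has_field_derivative D') (at x)" "D \<longlonglongrightarrow> D'"
proof -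
  obtain r where r: "r > 0" and ball: "ball x r \<subseteq> S" using S by (auto simp: open_contains_ball)
  have inS: "x + d \<in> S" "x - d \<in> S" if "\<bar>d\<bar> < r" for d
    using that ball by (auto simp: subset_eq dist_real_def)
  have midS: "y \<in> S" if "convex S" "y + d \<in> S" "y - d \<in> S" for y d
  proof -
    have "(1/2) *\<^sub>R (y + d) + (1/2) *\<^sub>R (y - d) = y" by (simp add: field_simps)
    then show ?thesis using convexD[OF that, of "1/2" "1/2"] by simp
  qed
  have ev: "\<forall>\<^sub>F n in sequentially. n > 0" by (rule eventually_gt_at_top)
  have cS: "convex S" using conv[of 1] by (simp add: convex_on_def)
  have convg: "convex_on S g"
  proof (rule convex_onI[OF _ cS])
    fix t y z :: real assume t: "0 < t" "t < 1" and yz: "y \<in> S" "z \<in> S"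
    have w: "(1 - t) *\<^sub>R y + t *\<^sub>R z \<in> S" using cS yz t by (intro convexD) auto
    show "g ((1 - t) *\<^sub>R y + t *\<^sub>R z) \<le> (1 - t) * g y + t * g z"
    proof (rule tendsto_le[OF trivial_limit_sequentially])
      show "(\<lambda>n. f n ((1 - t) *\<^sub>R y + t *\<^sub>R z)) \<longlonglongrightarrow> g ((1 - t) *\<^sub>R y + t *\<^sub>R z)" by (rule lim[OF w])
      show "(\<lambda>n. (1 - t) * f n y + t * f n z) \<longlonglongrightarrow> (1 - t) * g y + t * g z"
        using yz by (intro tendsto_intros lim)
      show "\<forall>\<^sub>F n in sequentially. f n ((1 - t) *\<^sub>R y + t *\<^sub>R z) \<le> (1 - t) * f n y + t * f n z"
        using ev
      proof eventually_elim
        case (elim n)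
        show ?case by (rule convex_onD[OF conv]) (use elim yz t in auto)
      qed
    qed
  qed
  have semig: "g (y + d) + g (y - d) \<le> 2 * g y + C * d\<^sup>2" if yd: "y + d \<in> S" "y - d \<in> S" for y d
  proof (rule tendsto_le[OF trivial_limit_sequentially])
    show "(\<lambda>n. f n (y + d) + f n (y - d)) \<longlonglongrightarrow> g (y + d) + g (y - d)" using yd by (intro tendsto_intros lim)
    show "(\<lambda>n. 2 * f n y + C * d\<^sup>2) \<longlonglongrightarrow> 2 * g y + C * d\<^sup>2" using midS[OF cS yd] by (intro tendsto_intros lim)
    show "\<forall>\<^sub>F n in sequentially. f n (y + d) + f n (y - d) \<le> 2 * f n y + C * d\<^sup>2"
      using ev by eventually_elim (use semi yd in auto)
  qed
  obtain D' where D': "\<And>d. x + d \<in> S \<Longrightarrow> x - d \<in> S \<Longrightarrow> \<bar>g (x + d) - g x - D' * d\<bar> \<le> C * d\<^sup>2"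
    using convex_on_semiconcave_taylor[OF convg S(1) semig S(2)] by blast
  have "\<exists>D. \<forall>d. x + d \<in> S \<longrightarrow> x - d \<in> S \<longrightarrow> \<bar>f n (x + d) - f n x - D * d\<bar> \<le> C * d\<^sup>2" if "n > 0" for n
    using convex_on_semiconcave_taylor[OF conv[OF that] S(1) semi[OF that] S(2)] by blast
  then obtain D where D: "\<And>n d. n > 0 \<Longrightarrow> x + d \<in> S \<Longrightarrow> x - d \<in> S \<Longrightarrow> \<bar>f n (x + d) - f n x - D n * d\<bar> \<le> C * d\<^sup>2"
    by metis
  have "C * (r/2)\<^sup>2 \<ge> 0" using D'[of "r/2"] inS[of "r/2"] r by linarith
  then have C: "C \<ge> 0" using r by (simp add: zero_le_mult_iff)
  have "D \<longlonglongrightarrow> D'"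
  proof (rule tendstoI)
    fix e :: real assume e: "e > 0"
    \<comment> \<open>This step makes the two remainders together at most \<open>e * d / 2\<close>;
      pointwise convergence at \<open>x\<close> and \<open>x + d\<close> supplies the other half.
      The summand 1 avoids division by zero when \<open>C = 0\<close> and makes
      \<open>4 * (C * d) < e\<close> strict.\<close>
    define d where "d = min (r / 2) (e / (4 * (C + 1)))"
    have d: "d > 0" "d < r" using r e C by (auto simp: d_def min_less_iff_disj)
    have "d * (4 * (C + 1)) \<le> e" using C by (simp add: d_def min_mult_distrib_right min_le_iff_disj)
    with d have Cd: "4 * (C * d) < e" by (simp add: algebra_simps)
    have dS: "x + d \<in> S" "x - d \<in> S" using inS[of d] d by auto
    have t: "(\<lambda>n. f n (x + d) - f n x) \<longlonglongrightarrow> g (x + d) - g x"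
      using dS S by (intro tendsto_intros lim)
    have "e * d / 2 > 0" using e d by simp
    from tendstoD[OF t this] ev show "\<forall>\<^sub>F n in sequentially. dist (D n) D' < e"
    proof eventually_elim
      case (elim n)
      have "\<bar>(D n - D') * d\<bar> \<le> \<bar>f n (x + d) - f n x - D n * d\<bar> + \<bar>g (x + d) - g x - D' * d\<bar>
          + \<bar>(f n (x + d) - f n x) - (g (x + d) - g x)\<bar>"
        by (simp add: left_diff_distrib)
      also have "\<dots> < C * d\<^sup>2 + C * d\<^sup>2 + e * d / 2"
        using D[OF elim(2) dS] D'[OF dS] elim(1) by (simp add: dist_real_def)
      also have "\<dots> \<le> e * d"
      proof -
        have "4 * (C * d\<^sup>2) \<le> e * d"
          using mult_right_mono[OF less_imp_le[OF Cd], of d] d by (simp add: power2_eq_square)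
        then show ?thesis by linarith
      qed
      finally show ?case using d by (simp add: abs_mult dist_real_def)
    qed
  qed
  moreover have "(g has_field_derivative D') (at x)"
    using r D' inS by (intro has_field_derivative_of_quadratic_bound[of r]) auto
  moreover have "(f n has_field_derivative D n) (at x)" if "n > 0" for n
    using r D[OF that] inS by (intro has_field_derivative_of_quadratic_bound[of r]) auto
  ultimately show thesis using that by blast
qed

section \<open>Moments of the partition function\<close>

text \<open>This is Hoelder's inequality: after division by their means \<open>?A\<close> and
  \<open>?B\<close>, the two powers of \<open>W\<close> satisfy Young's inequality pointwise, and
  the right side integrates to 1.\<close>

lemma (in prob_space) convex_on_ln_moment:
  assumes pos: "\<And>x. W x > (0::real)" and S: "convex S"
    and int: "\<And>l. l \<in> S \<Longrightarrow> integrable M (\<lambda>x. W x powr l)"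
  shows "convex_on S (\<lambda>l. ln (\<integral>x. W x powr l \<partial>M))"
proof (rule convex_onI[OF _ S])
  have moment_pos: "(\<integral>x. W x powr l \<partial>M) > 0" if "l \<in> S" for l
    using that int less_imp_neq[OF pos, symmetric] by (intro expectation_greater) auto
  fix t k l :: real assume t: "0 < t" "t < 1" and kl: "k \<in> S" "l \<in> S"
  let ?A = "\<integral>x. W x powr k \<partial>M" and ?B = "\<integral>x. W x powr l \<partial>M" and ?r = "(1 - t) *\<^sub>R k + t *\<^sub>R l"
  have r: "?r \<in> S" using S kl t by (intro convexD) auto
  have AB: "?A > 0" "?B > 0" using moment_pos kl by auto
  define c where "c = ?A powr (1 - t) * ?B powr t"
  have c: "c > 0" using AB by (simp add: c_def)
  have "W x powr ?r \<le> c * ((1 - t) * (W x powr k / ?A) + t * (W x powr l / ?B))" for x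
  proof -
    have "(W x powr k / ?A) powr (1 - t) * (W x powr l / ?B) powr t
        \<le> (1 - t) * (W x powr k / ?A) + t * (W x powr l / ?B)"
      using less_imp_neq[OF pos, symmetric] AB t by (intro Youngs_inequality_0 divide_pos_pos) auto
    also have "(W x powr k / ?A) powr (1 - t) * (W x powr l / ?B) powr t = W x powr ?r / c"
      using pos[of x] AB by (simp add: c_def powr_divide powr_powr powr_add[symmetric] mult.commute add.commute)
    finally show ?thesis using c by (simp add: field_simps)
  qed
  then have "(\<integral>x. W x powr ?r \<partial>M) \<le> (\<integral>x. c * ((1 - t) * (W x powr k / ?A) + t * (W x powr l / ?B)) \<partial>M)"
    using int kl r by (intro integral_mono) auto
  also have "\<dots> = c * ((1 - t) * (?A / ?A) + t * (?B / ?B))"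
    using int kl by (simp add: distrib_left)
  also have "\<dots> = c" using AB by simp
  finally have "ln (\<integral>x. W x powr ?r \<partial>M) \<le> ln c" using moment_pos[OF r] by simp
  also have "ln c = (1 - t) * ln ?A + t * ln ?B" using AB by (simp add: c_def ln_mult ln_powr)
  finally show "ln (\<integral>x. W x powr ?r \<partial>M) \<le> (1 - t) * ln ?A + t * ln ?B" .
qed

section \<open>Pointwise estimates for the partition function\<close>

definition exponent :: "real \<Rightarrow> real \<Rightarrow> nat \<Rightarrow> (nat \<Rightarrow> real) \<Rightarrow> (nat \<times> nat \<Rightarrow> real) \<Rightarrow> real" where
  "exponent b h N s x = b / sqrt (real N) * (\<Sum>(i, j)\<in>{1..N} \<times> {1..N}. x (i, j) * s i * s j) + h * (\<Sum>i=1..N. s i)"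

lemma Z_eq_sum_exponent: "Z b h N x = (\<Sum>s\<in>spins N. exp (exponent b h N s x))"
  by (simp add: Z_def exponent_def sum.cartesian_product)

lemma finite_spins: "finite (spins N)"
  unfolding spins_def by (intro finite_PiE) auto

lemma spin_one_mem: "(\<lambda>i\<in>{1..N}. 1) \<in> spins N"
  by (simp add: spins_def)

text \<open>Keeping only the configuration with all spins \<open>+1\<close> gives positivity and,
  for negative powers of \<open>Z\<close>, an explicit majorant.\<close>

lemma Z_ge_exp: "exp (exponent b h N (\<lambda>i\<in>{1..N}. 1) x) \<le> Z b h N x"
  unfolding Z_eq_sum_exponent by (rule member_le_sum[OF spin_one_mem]) (auto simp: finite_spins)

lemma Z_pos: "Z b h N x > 0"
  using Z_ge_exp by (rule less_le_trans[rotated]) simp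

lemma Z_measurable: "Z b h N \<in> borel_measurable (std_gaussian N)"
proof -
  have [measurable]: "(\<lambda>x. x p) \<in> borel_measurable (std_gaussian N)" if "p \<in> {1..N} \<times> {1..N}" for p
    using measurable_component_singleton[OF that, of "\<lambda>_. gaussian"] by (simp add: std_gaussian_def)
  have "exponent b h N s \<in> borel_measurable (std_gaussian N)" for s
    unfolding exponent_def case_prod_unfold
    by (intro borel_measurable_add borel_measurable_times borel_measurable_sum borel_measurable_const) auto
  then show ?thesis unfolding Z_eq_sum_exponent[abs_def] by measurable
qed

text \<open>Midpoint convexity of \<open>ln Z\<close> in the disorder: each exponent is affine in
  \<open>x\<close>, so Cauchy-Schwarz over the spin configurations applies.\<close>

lemma Z_midpoint: "(Z b h N (\<lambda>p\<in>{1..N} \<times> {1..N}. (x p + y p) / 2))\<^sup>2 \<le> Z b h N x * Z b h N y"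
proof -
  let ?z = "\<lambda>p\<in>{1..N} \<times> {1..N}. (x p + y p) / 2"
  have "exponent b h N s ?z = exponent b h N s x / 2 + exponent b h N s y / 2" for s
  proof -
    have "(\<Sum>(i, j)\<in>{1..N} \<times> {1..N}. ?z (i, j) * s i * s j)
        = (\<Sum>(i, j)\<in>{1..N} \<times> {1..N}. x (i, j) * s i * s j) / 2 + (\<Sum>(i, j)\<in>{1..N} \<times> {1..N}. y (i, j) * s i * s j) / 2"
      unfolding sum_divide_distrib sum.distrib[symmetric]
      by (intro sum.cong) (auto simp: field_simps)
    moreover have "c * (u / 2 + v / 2) + k = (c * u + k) / 2 + (c * v + k) / 2" for c u v k :: real
      by (simp add: field_simps)
    ultimately show ?thesis unfolding exponent_def by (simp only:)
  qed
  then have "(Z b h N ?z)\<^sup>2 = (\<Sum>s\<in>spins N. exp (exponent b h N s x / 2) * exp (exponent b h N s y / 2))\<^sup>2"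
    by (simp add: Z_eq_sum_exponent exp_add)
  also have "\<dots> \<le> (\<Sum>s\<in>spins N. (exp (exponent b h N s x / 2))\<^sup>2) * (\<Sum>s\<in>spins N. (exp (exponent b h N s y / 2))\<^sup>2)"
    by (rule Cauchy_Schwarz_ineq_sum)
  also have "\<dots> = Z b h N x * Z b h N y"
    by (simp add: Z_eq_sum_exponent flip: exp_double)
  finally show ?thesis .
qed

text \<open>Products of spins have modulus 1, so every exponent has the same Lipschitz bound in the
  entries. The bound is a sum over coordinates so that squares can later be completed entry by
  entry.\<close>

lemma Z_le_Z_mult_exp:
  assumes "b \<ge> 0"
  shows "Z b h N x \<le> Z b h N y * exp (b / sqrt N * (\<Sum>p\<in>{1..N} \<times> {1..N}. \<bar>x p - y p\<bar>))"
  unfolding Z_eq_sum_exponent sum_distrib_right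
proof (rule sum_mono)
  fix s assume s: "s \<in> spins N"
  have abs1: "\<bar>s i\<bar> = 1" if "i \<in> {1..N}" for i
  proof -
    have "s i \<in> {-1, 1}" using s that unfolding spins_def by (rule PiE_mem)
    then show ?thesis by auto
  qed
  have "(\<Sum>(i, j)\<in>{1..N} \<times> {1..N}. x (i, j) * s i * s j) - (\<Sum>(i, j)\<in>{1..N} \<times> {1..N}. y (i, j) * s i * s j)
      = (\<Sum>(i, j)\<in>{1..N} \<times> {1..N}. (x (i, j) - y (i, j)) * s i * s j)"
    unfolding sum_subtractf[symmetric] by (intro sum.cong) (auto simp: algebra_simps)
  also have "\<dots> \<le> (\<Sum>p\<in>{1..N} \<times> {1..N}. \<bar>x p - y p\<bar>)"
  proof (rule sum_mono)
    fix p assume "p \<in> {1..N} \<times> {1..N}"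
    then obtain i j where p: "p = (i, j)" "i \<in> {1..N}" "j \<in> {1..N}" by auto
    have "(x p - y p) * s i * s j \<le> \<bar>(x p - y p) * s i * s j\<bar>" by simp
    also have "\<dots> = \<bar>x p - y p\<bar>" using p abs1 by (simp add: abs_mult)
    finally show "(case p of (i, j) \<Rightarrow> (x (i, j) - y (i, j)) * s i * s j) \<le> \<bar>x p - y p\<bar>" by (simp add: p)
  qed
  finally have "b / sqrt N * ((\<Sum>(i, j)\<in>{1..N} \<times> {1..N}. x (i, j) * s i * s j) - (\<Sum>(i, j)\<in>{1..N} \<times> {1..N}. y (i, j) * s i * s j))
      \<le> b / sqrt N * (\<Sum>p\<in>{1..N} \<times> {1..N}. \<bar>x p - y p\<bar>)"
    using assms by (intro mult_left_mono) auto
  then show "exp (exponent b h N s x) \<le> exp (exponent b h N s y) * exp (b / sqrt N * (\<Sum>p\<in>{1..N} \<times> {1..N}. \<bar>x p - y p\<bar>))"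
    unfolding exp_add[symmetric] exp_le_cancel_iff by (simp add: exponent_def right_diff_distrib)
qed

section \<open>Integrability of negative powers of the partition function\<close>

lemma prob_space_gaussian: "prob_space gaussian"
  by (rule prob_space_normal_density) simp

lemma prob_space_std_gaussian: "prob_space (std_gaussian N)"
  unfolding std_gaussian_def by (intro prob_space_PiM prob_space_gaussian)

text \<open>Completing the square turns the tilted density into a multiple of the normal density
  with mean \<open>c\<close>.\<close>

lemma integrable_exp_gaussian: "integrable gaussian (\<lambda>t. exp (c * t))"
proof -
  have "std_normal_density t * exp (c * t) = exp (c\<^sup>2 / 2) * normal_density c 1 t" for t
  proof -
    have "- t\<^sup>2 / 2 + c * t = c\<^sup>2 / 2 + - (t - c)\<^sup>2 / 2" by (simp add: power2_eq_square field_simps)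
    then have "exp (- t\<^sup>2 / 2) * exp (c * t) = exp (c\<^sup>2 / 2) * exp (- (t - c)\<^sup>2 / 2)"
      unfolding exp_add[symmetric] by simp
    then show ?thesis by (simp add: normal_density_def)
  qed
  then show ?thesis by (subst integrable_real_density) auto
qed

text \<open>For \<open>l < 0\<close> the lower bound \<open>Z_ge_exp\<close> becomes an upper bound
  whose exponent is affine in the entries, so the majorant factors over the independent
  coordinates.\<close>

lemma integrable_Z_powr:
  assumes "l < 0"
  shows "integrable (std_gaussian N) (\<lambda>x. Z b h N x powr l)"
proof (rule Bochner_Integration.integrable_bound)
  interpret product_sigma_finite "\<lambda>_::nat \<times> nat. gaussian"
    unfolding product_sigma_finite_def using prob_space_gaussian by (auto intro: prob_space_imp_sigma_finite)
  show "integrable (std_gaussian N) (\<lambda>x. exp (l * h * N) * (\<Prod>p\<in>{1..N} \<times> {1..N}. exp (l * (b / sqrt N) * x p)))"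
    unfolding std_gaussian_def
    by (intro integrable_mult_right product_integrable_prod integrable_exp_gaussian) auto
  show "(\<lambda>x. Z b h N x powr l) \<in> borel_measurable (std_gaussian N)"
    using Z_measurable by measurable
  show "AE x in std_gaussian N. norm (Z b h N x powr l) \<le> norm (exp (l * h * N) * (\<Prod>p\<in>{1..N} \<times> {1..N}. exp (l * (b / sqrt N) * x p)))"
  proof (rule AE_I2)
    fix x
    have "exponent b h N (\<lambda>i\<in>{1..N}. 1) x = b / sqrt N * (\<Sum>p\<in>{1..N} \<times> {1..N}. x p) + h * N"
    proof -
      have "(\<Sum>(i, j)\<in>{1..N} \<times> {1..N}. x (i, j) * (\<lambda>i\<in>{1..N}. 1) i * (\<lambda>i\<in>{1..N}. 1) j) = (\<Sum>p\<in>{1..N} \<times> {1..N}. x p)"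
        by (intro sum.cong) auto
      then show ?thesis by (simp add: exponent_def)
    qed
    then have "Z b h N x powr l \<le> exp (b / sqrt N * (\<Sum>p\<in>{1..N} \<times> {1..N}. x p) + h * N) powr l"
      using Z_ge_exp[of b h N x] assms by (intro powr_mono2') auto
    also have "\<dots> = exp (l * h * N) * (\<Prod>p\<in>{1..N} \<times> {1..N}. exp (l * (b / sqrt N) * x p))"
      by (simp add: powr_def exp_sum[symmetric] exp_add[symmetric] sum_distrib_left algebra_simps)
    finally show "norm (Z b h N x powr l) \<le> norm (exp (l * h * N) * (\<Prod>p\<in>{1..N} \<times> {1..N}. exp (l * (b / sqrt N) * x p)))"
      by (simp add: prod_nonneg)
  qed
qed

lemma moment_pos:
  assumes "l < 0"
  shows "(\<integral>x. Z b h N x powr l \<partial>std_gaussian N) > 0"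
  using assms by (intro prob_space.expectation_greater prob_space_std_gaussian integrable_Z_powr)
    (auto simp: Z_pos less_imp_neq[OF Z_pos, symmetric])

text \<open>The pointwise hypothesis of the Gaussian Prekopa-Leindler inequality. In the logarithm,
  the part with factor \<open>l\<close> is controlled by midpoint convexity of \<open>ln Z\<close>,
  and the part with factor \<open>d\<close> by the Lipschitz bound, whose growth the quadratic
  weight absorbs.\<close>

lemma Z_powr_midpoint:
  assumes "b \<ge> 0" "N > 0" "l < 0"
  shows "Z b h N x powr (l + d) * Z b h N y powr (l - d) * exp (- (\<Sum>p\<in>{1..N} \<times> {1..N}. (x p - y p)\<^sup>2) / 4)
    \<le> (exp (b\<^sup>2 * d\<^sup>2 * N / 2) * Z b h N (\<lambda>p\<in>{1..N} \<times> {1..N}. (x p + y p) / 2) powr l)\<^sup>2"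
proof -
  let ?I = "{1..N} \<times> {1..N}"
  let ?X = "Z b h N x" and ?Y = "Z b h N y" and ?z = "Z b h N (\<lambda>p\<in>?I. (x p + y p) / 2)"
  let ?D = "b / sqrt N * (\<Sum>p\<in>?I. \<bar>x p - y p\<bar>)"
  note pos = Z_pos[of b h N]
  have "\<bar>ln ?X - ln ?Y\<bar> \<le> ?D"
  proof -
    have "ln ?X \<le> ln (?Y * exp ?D)" using Z_le_Z_mult_exp[OF assms(1), of h N x y] pos by simp
    moreover have "ln ?Y \<le> ln (?X * exp ?D)"
      using Z_le_Z_mult_exp[OF assms(1), of h N y x] pos by (simp add: abs_minus_commute)
    ultimately show ?thesis using pos[of x] pos[of y] by (simp add: ln_mult)
  qed
  then have "\<bar>d\<bar> * \<bar>ln ?X - ln ?Y\<bar> \<le> \<bar>d\<bar> * ?D" by (rule mult_left_mono) simp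
  then have "d * (ln ?X - ln ?Y) \<le> \<bar>d\<bar> * ?D" unfolding abs_mult[symmetric] by linarith
  also have "\<bar>d\<bar> * ?D = (\<Sum>p\<in>?I. \<bar>d\<bar> * (b / sqrt N) * \<bar>x p - y p\<bar>)"
    by (simp add: sum_distrib_left mult_ac)
  also have "\<dots> \<le> (\<Sum>p\<in>?I. (x p - y p)\<^sup>2 / 4 + b\<^sup>2 * d\<^sup>2 / N)"
  proof (rule sum_mono)
    fix p
    \<comment> \<open>Each entry costs \<open>b^2 * d^2 / N\<close>; over the \<open>N^2\<close>
      entries this adds up to \<open>b^2 * d^2 * N\<close>, linear in \<open>N\<close>.\<close>
    have "0 \<le> (\<bar>x p - y p\<bar> / 2 - \<bar>d\<bar> * (b / sqrt N))\<^sup>2" by simp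
    also have "\<dots> = \<bar>x p - y p\<bar>\<^sup>2 / 4 - \<bar>d\<bar> * (b / sqrt N) * \<bar>x p - y p\<bar> + \<bar>d\<bar>\<^sup>2 * (b\<^sup>2 / (sqrt N)\<^sup>2)"
      by (simp only: power2_diff power_divide power_mult_distrib) simp
    finally show "\<bar>d\<bar> * (b / sqrt N) * \<bar>x p - y p\<bar> \<le> (x p - y p)\<^sup>2 / 4 + b\<^sup>2 * d\<^sup>2 / N"
      by (simp add: mult.commute)
  qed
  also have "\<dots> = (\<Sum>p\<in>?I. (x p - y p)\<^sup>2) / 4 + b\<^sup>2 * d\<^sup>2 * N"
    using assms(2) by (simp add: sum.distrib sum_divide_distrib card_cartesian_product)
  finally have 1: "d * (ln ?X - ln ?Y) - (\<Sum>p\<in>?I. (x p - y p)\<^sup>2) / 4 \<le> b\<^sup>2 * d\<^sup>2 * N" by simp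
  have "ln (?z\<^sup>2) \<le> ln (?X * ?Y)"
    using Z_midpoint[of b h N x y] by (intro ln_mono zero_less_power mult_pos_pos pos)
  then have "2 * ln ?z \<le> ln ?X + ln ?Y"
    using pos[of x] pos[of y] pos by (simp add: ln_mult ln_realpow)
  \<comment> \<open>The sign of \<open>l\<close> enters here: multiplication by \<open>l < 0\<close>
    reverses the convexity inequality.\<close>
  then have 2: "l * (ln ?X + ln ?Y) \<le> l * (2 * ln ?z)" using assms(3) by (intro mult_left_mono_neg) auto
  have "?X powr (l + d) * ?Y powr (l - d) * exp (- (\<Sum>p\<in>?I. (x p - y p)\<^sup>2) / 4)
      = exp (l * (ln ?X + ln ?Y) + (d * (ln ?X - ln ?Y) - (\<Sum>p\<in>?I. (x p - y p)\<^sup>2) / 4))"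
    using pos[of x] pos[of y] by (simp add: powr_def exp_add[symmetric] algebra_simps)
  also have "\<dots> \<le> exp (l * (2 * ln ?z) + b\<^sup>2 * d\<^sup>2 * N)"
    unfolding exp_le_cancel_iff by (rule add_mono[OF 2 1])
  also have "\<dots> = (exp (b\<^sup>2 * d\<^sup>2 * N / 2 + l * ln ?z))\<^sup>2"
    unfolding exp_double[symmetric] by (simp add: algebra_simps)
  also have "\<dots> = (exp (b\<^sup>2 * d\<^sup>2 * N / 2) * ?z powr l)\<^sup>2"
    using pos by (simp add: powr_def exp_add less_imp_neq[OF Z_pos, symmetric])
  finally show ?thesis .
qed

text \<open>All three exponents are negative, so the moments are finite and the inequality for
  extended nonnegative integrals transfers to the reals.\<close>

lemma moment_midpoint:
  assumes "b \<ge> 0" "N > 0" "l + d < 0" "l - d < 0"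
  shows "(\<integral>x. Z b h N x powr (l + d) \<partial>std_gaussian N) * (\<integral>x. Z b h N x powr (l - d) \<partial>std_gaussian N)
    \<le> (exp (b\<^sup>2 * d\<^sup>2 * N / 2) * (\<integral>x. Z b h N x powr l \<partial>std_gaussian N))\<^sup>2"
proof -
  let ?G = "std_gaussian N" and ?c = "exp (b\<^sup>2 * d\<^sup>2 * N / 2)"
  let ?m = "\<lambda>l. \<integral>x. Z b h N x powr l \<partial>?G"
  have l: "l < 0" using assms by simp
  have conv: "(\<integral>\<^sup>+x. ennreal (Z b h N x powr k) \<partial>?G) = ennreal (?m k)" if "k < 0" for k
    using that by (intro nn_integral_eq_integral integrable_Z_powr) auto
  have meas: "(\<lambda>x. ennreal (Z b h N x powr k)) \<in> borel_measurable ?G" for k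
    using Z_measurable by measurable
  have "(\<integral>\<^sup>+x. ennreal (Z b h N x powr (l + d)) \<partial>?G) * (\<integral>\<^sup>+x. ennreal (Z b h N x powr (l - d)) \<partial>?G)
      \<le> (\<integral>\<^sup>+x. ennreal ?c * ennreal (Z b h N x powr l) \<partial>?G)\<^sup>2"
  proof (rule prekopa_leindler_std_gaussian)
    show "ennreal (Z b h N x powr (l + d)) * ennreal (Z b h N y powr (l - d)) *
        ennreal (exp (- (\<Sum>p\<in>{1..N} \<times> {1..N}. (x p - y p)\<^sup>2) / 4))
      \<le> (ennreal ?c * ennreal (Z b h N (\<lambda>p\<in>{1..N} \<times> {1..N}. (x p + y p) / 2) powr l))\<^sup>2" for x y
      using ennreal_leI[OF Z_powr_midpoint[OF assms(1,2) l, of h x d y]]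
      by (simp only: ennreal_mult' ennreal_power[symmetric] powr_ge_zero exp_ge_zero mult_nonneg_nonneg)
  qed (use meas in measurable)
  also have "(\<integral>\<^sup>+x. ennreal ?c * ennreal (Z b h N x powr l) \<partial>?G) = ennreal ?c * ennreal (?m l)"
    unfolding conv[OF l, symmetric] by (rule nn_integral_cmult[OF meas])
  finally have "ennreal (?m (l + d) * ?m (l - d)) \<le> ennreal ((?c * ?m l)\<^sup>2)"
    using assms l by (simp add: conv ennreal_mult ennreal_power[symmetric] less_imp_le moment_pos)
  then show ?thesis by (subst (asm) ennreal_le_iff) auto
qed

text \<open>For \<open>l \<noteq> 0\<close> this is \<open>l * Gamma_N b h N l\<close>, multiplied
  out because convexity and the second-difference bound hold for this product.\<close>

definition log_moment :: "real \<Rightarrow> real \<Rightarrow> nat \<Rightarrow> real \<Rightarrow> real" where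
  "log_moment b h N l = ln (\<integral>x. Z b h N x powr l \<partial>std_gaussian N) / N"

lemma Gamma_N_eq: "l \<noteq> 0 \<Longrightarrow> Gamma_N b h N l = log_moment b h N l / l"
  by (simp add: Gamma_N_def log_moment_def)

lemma log_moment_convex: "convex_on {..<0} (log_moment b h N)"
  unfolding log_moment_def[abs_def]
  by (intro convex_on_cdiv prob_space.convex_on_ln_moment prob_space_std_gaussian) (auto simp: Z_pos integrable_Z_powr)

text \<open>After taking logarithms in \<open>moment_midpoint\<close>, division by \<open>N\<close>
  cancels the factor \<open>N\<close> of the error, leaving the constant \<open>b^2\<close> uniform
  in \<open>N\<close>.\<close>

lemma log_moment_semiconcave:
  assumes "b \<ge> 0" "N > 0" "l + d < 0" "l - d < 0"
  shows "log_moment b h N (l + d) + log_moment b h N (l - d) \<le> 2 * log_moment b h N l + b\<^sup>2 * d\<^sup>2"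
proof -
  let ?m = "\<lambda>l. \<integral>x. Z b h N x powr l \<partial>std_gaussian N"
  have l: "l < 0" using assms by simp
  note pos = moment_pos[OF l, of N b h] moment_pos[OF assms(3), of N b h] moment_pos[OF assms(4), of N b h]
  have "ln (?m (l + d) * ?m (l - d)) \<le> ln ((exp (b\<^sup>2 * d\<^sup>2 * N / 2) * ?m l)\<^sup>2)"
    using pos by (intro ln_mono moment_midpoint assms) auto
  then have "ln (?m (l + d)) + ln (?m (l - d)) \<le> 2 * ln (?m l) + b\<^sup>2 * d\<^sup>2 * N"
    using pos by (simp add: ln_mult ln_realpow)
  then have "(ln (?m (l + d)) + ln (?m (l - d))) / N \<le> (2 * ln (?m l) + b\<^sup>2 * d\<^sup>2 * N) / N"
    by (rule divide_right_mono) simp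
  then show ?thesis using assms(2) by (simp add: log_moment_def add_divide_distrib)
qed

section \<open>Passage to the limit and return from log-moments to \<open>Gamma_N\<close>\<close>

theorem theorem5:
  fixes b h :: real and \<Gamma> :: "real \<Rightarrow> real"
  assumes "b > 0"
    and "\<And>l. (\<lambda>N. Gamma_N b h N l) \<longlonglongrightarrow> \<Gamma> l"
  shows "\<forall>l<0. \<Gamma> field_differentiable (at l) \<and>
           (\<lambda>N. deriv (Gamma_N b h N) l) \<longlonglongrightarrow> deriv \<Gamma> l"
proof (intro allI impI)
  fix l :: real assume l: "l < 0"
  have lim: "(\<lambda>N. log_moment b h N k) \<longlonglongrightarrow> k * \<Gamma> k" if "k < 0" for k
    using tendsto_mult_left[OF assms(2), of k k] that by (simp add: Gamma_N_eq)
  obtain D D' where D: "\<And>N. N > 0 \<Longrightarrow> (log_moment b h N has_field_derivative D N) (at l)"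
      "((\<lambda>k. k * \<Gamma> k) has_field_derivative D') (at l)" "D \<longlonglongrightarrow> D'"
    by (rule convex_semiconcave_limit_derivative[of "{..<0}" l "log_moment b h" "b\<^sup>2" "\<lambda>k. k * \<Gamma> k"])
      (use assms(1) l lim in \<open>auto intro: log_moment_convex log_moment_semiconcave\<close>)
  have near: "\<forall>\<^sub>F k in nhds l. k \<noteq> 0"
    using l by (intro t1_space_nhds) auto
  \<comment> \<open>The quotient rule, stated for functions that agree with \<open>G k / k\<close>
    only away from 0; this suffices near \<open>l < 0\<close>. The term \<open>G l / l\<close> is
    the value of \<open>F\<close> itself, so its convergence will be the assumed one.\<close>
  have quot: "(F has_field_derivative (E - G l / l) / l) (at l)"
    if "(G has_field_derivative E) (at l)" "\<And>k. k \<noteq> 0 \<Longrightarrow> F k = G k / k" for F G :: "real \<Rightarrow> real" and E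
  proof -
    have "((\<lambda>k. G k / k) has_field_derivative (E - G l / l) / l) (at l)"
      using l by (auto intro!: derivative_eq_intros that(1) simp: field_simps)
    moreover have "\<forall>\<^sub>F k in nhds l. F k = G k / k" using near by eventually_elim (rule that(2))
    ultimately show ?thesis by (subst DERIV_cong_ev) auto
  qed
  have dN: "deriv (Gamma_N b h N) l = (D N - Gamma_N b h N l) / l" if "N > 0" for N
    using DERIV_imp_deriv[OF quot[OF D(1)[OF that] Gamma_N_eq]] l by (simp add: Gamma_N_eq)
  have d: "(\<Gamma> has_field_derivative (D' - \<Gamma> l) / l) (at l)"
    using quot[OF D(2), of \<Gamma>] l by simp
  have "(\<lambda>N. (D N - Gamma_N b h N l) / l) \<longlonglongrightarrow> (D' - \<Gamma> l) / l"
    using l by (intro tendsto_intros D(3) assms(2)) auto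
  \<comment> \<open>The derivative formula is available only for \<open>N > 0\<close>, so the
    sequences are identified eventually.\<close>
  moreover have "\<forall>\<^sub>F N in sequentially. (D N - Gamma_N b h N l) / l = deriv (Gamma_N b h N) l"
    using eventually_gt_at_top[of 0] by eventually_elim (simp add: dN)
  ultimately have "(\<lambda>N. deriv (Gamma_N b h N) l) \<longlonglongrightarrow> (D' - \<Gamma> l) / l"
    by (rule Lim_transform_eventually)
  then show "\<Gamma> field_differentiable (at l) \<and> (\<lambda>N. deriv (Gamma_N b h N) l) \<longlonglongrightarrow> deriv \<Gamma> l"
    using d DERIV_imp_deriv[OF d] by (auto simp: field_differentiable_def)
qed

end
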